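(* Let $a>0$ and $b>0$ be real constants, let $f\in L^1_{loc}([0,\infty);\mathbb{R})$, let $\xi_0,\xi_1\in\mathbb{R}$, and let $x$ be the unique continuous solution on $[0,\infty)$ of $$x''(t)+ax'(t)+bx(t)=f(t),\quad t\ge 0;\qquad x(0)=\xi_0,\ x'(0)=\xi_1.$$ Let $$F_{(\theta_1,\theta_2)}(t)=\int_{(t-\theta_1)^+}^t\int_{(s-\theta_2)^+}^s f(u)\,du\,ds,\qquad t\ge 0,\ \theta_1,\theta_2\in[0,1],$$ and define $$\bar X=\limsup_{t\to\infty}|x(t)|\in[0,\infty],\qquad \bar F=\limsup_{t\to\infty}\ \sup_{(\theta_1,\theta_2)\in[0,1]^2}|F_{(\theta_1,\theta_2)}(t)|\in[0,\infty].$$ Then: (i) If $\bar F=0$, then $\bar X=0$. (ii) If $\bar F\in(0,\infty)$, then $\bar X\in(0,\infty)$. (iii) If $\bar F=+\infty$, then $\bar X=+\infty$.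
   Context: $u^+=\max(u,0)$. Since $f$ is only locally integrable, a solution of the differential equation is a function $x\in C^1([0,\infty);\mathbb{R})$ with $x'$ locally absolutely continuous, satisfying the equation for almost every $t\ge 0$ and the given initial conditions. *)

theory Defs
  imports "HOL-Analysis.Analysis"
begin

text \<open>
  Functions on the half-line are total functions on the reals whose values at negative
  arguments play no role.
\<close>

definition locally_integrable :: "(real \<Rightarrow> real) \<Rightarrow> bool" where
  "locally_integrable f \<longleftrightarrow> (\<forall>T\<ge>0. f absolutely_integrable_on {0..T})"

text \<open>
  The usual epsilon-delta definition: \<open>\<D>\<close> ranges over all finite families of
  non-overlapping compact subintervals \<open>{Inf K..Sup K}\<close> of \<open>{a..b}\<close>, which need not
  cover \<open>{a..b}\<close>. This is unrelated to \<^const>\<open>absolutely_continuous\<close>, which is about measures.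
\<close>
definition abs_continuous_on :: "real \<Rightarrow> real \<Rightarrow> (real \<Rightarrow> real) \<Rightarrow> bool" where
  "abs_continuous_on a b g \<longleftrightarrow>
     (\<forall>\<epsilon>>0. \<exists>\<delta>>0. \<forall>\<D>. \<D> division_of \<Union>\<D> \<and> \<Union>\<D> \<subseteq> {a..b} \<and> (\<Sum>K\<in>\<D>. Sup K - Inf K) < \<delta>
        \<longrightarrow> (\<Sum>K\<in>\<D>. \<bar>g (Sup K) - g (Inf K)\<bar>) < \<epsilon>)"

definition locally_abs_continuous :: "(real \<Rightarrow> real) \<Rightarrow> bool" where
  "locally_abs_continuous g \<longleftrightarrow> (\<forall>T\<ge>0. abs_continuous_on 0 T g)"

text \<open>
  In the next definition \<open>x'\<close> is the first derivative, one-sided at 0, and \<open>x''\<close> is the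
  pointwise derivative of \<open>x'\<close>, which is required to exist only almost everywhere.
\<close>
definition is_solution ::
  "real \<Rightarrow> real \<Rightarrow> (real \<Rightarrow> real) \<Rightarrow> real \<Rightarrow> real \<Rightarrow> (real \<Rightarrow> real) \<Rightarrow> bool" where
  "is_solution a b f \<xi>0 \<xi>1 x \<longleftrightarrow>
     (\<exists>x'. (\<forall>t\<ge>0. (x has_real_derivative x' t) (at t within {0..})) \<and>
           continuous_on {0..} x' \<and>
           locally_abs_continuous x' \<and>
           (AE t in lebesgue. t \<ge> 0 \<longrightarrow>
              (\<exists>x''. (x' has_real_derivative x'') (at t within {0..}) \<and>
                     x'' + a * x' t + b * x t = f t)) \<and>
           x 0 = \<xi>0 \<and> x' 0 = \<xi>1)"

definition F_avg :: "(real \<Rightarrow> real) \<Rightarrow> real \<Rightarrow> real \<Rightarrow> real \<Rightarrow> real" where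
  "F_avg f \<theta>1 \<theta>2 t =
     (LINT s:{max (t - \<theta>1) 0..t}|lebesgue. (LINT u:{max (s - \<theta>2) 0..s}|lebesgue. f u))"

definition X_bar :: "(real \<Rightarrow> real) \<Rightarrow> ereal" where
  "X_bar x = Limsup at_top (\<lambda>t. ereal \<bar>x t\<bar>)"

definition F_bar :: "(real \<Rightarrow> real) \<Rightarrow> ereal" where
  "F_bar f = Limsup at_top
     (\<lambda>t. SUP (\<theta>1, \<theta>2) \<in> {0..1} \<times> {0..1}. ereal \<bar>F_avg f \<theta>1 \<theta>2 t\<bar>)"

end

theory Submission
  imports Defs
begin

text \<open>
  Let \<open>\<Phi>\<close> be a second antiderivative of \<open>f\<close>. For \<open>t \<ge> 2\<close>, the averages \<open>F\<close> are the second differences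
  \<open>\<Phi>(t) - \<Phi>(t - \<theta>1) - \<Phi>(t - \<theta>2) + \<Phi>(t - \<theta>1 - \<theta>2)\<close>, and both limsups bound each other up to
  constants depending only on \<open>a\<close> and \<open>b\<close>.

  Integrating the equation twice writes \<open>\<Phi>\<close> as \<open>x + a X1 + b X2\<close> with \<open>X1' = x\<close>, \<open>X2' = X1\<close>, so second
  differences of \<open>\<Phi>\<close> are bounded by \<open>(4 + 2 a + b) sup \<bar>x\<bar>\<close>.

  Conversely, let \<open>Q\<close>, \<open>R\<close> be the averages of \<open>F\<close> over \<open>(\<theta>1, \<theta>2)\<close> and over \<open>\<theta>1\<close> with \<open>\<theta>2 = 1\<close>.
  Then \<open>f = Q'' + 2 R' + F\<^sub>1\<^sub>1\<close> in the sense of distributions, where \<open>F\<^sub>1\<^sub>1\<close> is \<open>F\<close> at \<open>\<theta>1 = \<theta>2 = 1\<close>.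
  Hence \<open>u = x - Q\<close> is the first component of an exponentially stable linear system driven by \<open>Q\<close>, \<open>R\<close>
  and \<open>F\<^sub>1\<^sub>1\<close> without derivatives, and a Lyapunov function bounds it.
\<close>

section \<open>Fundamental theorem of calculus for absolutely continuous functions\<close>

text \<open>
  In the gauge integral, pieces tagged outside \<open>N\<close> are controlled by differentiability, and pieces
  tagged in \<open>N\<close> are forced into an open set of small measure, where absolute continuity applies.
\<close>
lemma abs_continuous_on_has_integral:
  fixes v \<phi> :: "real \<Rightarrow> real"
  assumes "a \<le> b" and ac: "abs_continuous_on a b v" and N: "negligible N"
    and deriv: "\<And>t. t \<in> {a..b} - N \<Longrightarrow> (v has_real_derivative \<phi> t) (at t within {a..b})"
  shows "(\<phi> has_integral (v b - v a)) {a..b}"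
proof -
  \<comment> \<open>With value 0 on \<open>N\<close>, pieces tagged in \<open>N\<close> add nothing
    to the Riemann sum; only the increments of \<open>v\<close> over them remain to be
    estimated.\<close>
  define \<phi>0 where "\<phi>0 = (\<lambda>t. if t \<in> N then 0 else \<phi> t)"
  have "(\<phi>0 has_integral (v b - v a)) {a..b}"
    unfolding has_integral_real
  proof (intro allI impI)
    fix \<epsilon> :: real
    assume \<epsilon>: "\<epsilon> > 0"
    \<comment> \<open>The summand 1 keeps the quotient meaningful when \<open>a = b\<close>.\<close>
    define \<eta> where "\<eta> = \<epsilon> / (2 * (b - a + 1))"
    have \<eta>: "\<eta> > 0" and \<eta>_le: "\<eta> * (b - a) \<le> \<epsilon> / 2"
      using \<epsilon> \<open>a \<le> b\<close> by (auto simp: \<eta>_def field_simps)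
    obtain \<delta> where \<delta>: "\<delta> > 0"
      "\<And>\<D>. \<lbrakk>\<D> division_of \<Union>\<D>; \<Union>\<D> \<subseteq> {a..b}; (\<Sum>K\<in>\<D>. Sup K - Inf K) < \<delta>\<rbrakk>
         \<Longrightarrow> (\<Sum>K\<in>\<D>. \<bar>v (Sup K) - v (Inf K)\<bar>) < \<epsilon> / 2"
      using ac \<epsilon> unfolding abs_continuous_on_def by (meson half_gt_zero)
    obtain U where U: "open U" "N \<subseteq> U" "U - N \<in> lmeasurable" "emeasure lebesgue (U - N) < ennreal \<delta>"
      using sets_lebesgue_outer_open[OF negligible_imp_sets[OF N] \<delta>(1)] by blast
    have Um: "U \<in> lmeasurable" and U_less: "measure lebesgue U < \<delta>"
    proof -
      have eq: "U = (U - N) \<union> N" using U(2) by auto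
      have Nm: "N \<in> lmeasurable" using N by (rule negligible_imp_measurable)
      show "U \<in> lmeasurable" using fmeasurable.Un[OF U(3) Nm] eq by simp
      have "measure lebesgue U \<le> measure lebesgue (U - N) + measure lebesgue N"
        using measure_Un_le[of "U - N" lebesgue N] U(3) Nm eq by (simp add: fmeasurableD)
      also have "\<dots> = measure lebesgue (U - N)"
        using N by (simp add: negligible_imp_measure0)
      also have "\<dots> < \<delta>"
        using U(3,4) \<delta>(1) by (simp add: emeasure_eq_measure2 ennreal_less_iff)
      finally show "measure lebesgue U < \<delta>" .
    qed
    have "\<exists>d>0. (x \<in> {a..b} - N \<longrightarrow> (\<forall>y\<in>{a..b}. \<bar>y - x\<bar> < d \<longrightarrow> \<bar>v y - v x - \<phi> x * (y - x)\<bar> \<le> \<eta> * \<bar>y - x\<bar>))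
             \<and> (x \<in> N \<longrightarrow> ball x d \<subseteq> U)" for x
    proof (cases "x \<in> N")
      case True
      then show ?thesis using U(1,2) by (meson DiffD2 open_contains_ball subsetD)
    next
      case False
      show ?thesis
      proof (cases "x \<in> {a..b}")
        case True
        with False deriv[of x] have "(v has_derivative (\<lambda>h. \<phi> x * h)) (at x within {a..b})"
          by (simp add: has_field_derivative_def)
        with \<eta> False show ?thesis
          unfolding has_derivative_within_alt real_norm_def by blast
      next
        case False
        then show ?thesis using \<open>x \<notin> N\<close> by (intro exI[of _ 1]) auto
      qed
    qed
    then obtain d where d: "\<And>x. d x > 0"
      "\<And>x y. \<lbrakk>x \<in> {a..b} - N; y \<in> {a..b}; \<bar>y - x\<bar> < d x\<rbrakk>
         \<Longrightarrow> \<bar>v y - v x - \<phi> x * (y - x)\<bar> \<le> \<eta> * \<bar>y - x\<bar>"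
      "\<And>x. x \<in> N \<Longrightarrow> ball x (d x) \<subseteq> U"
      by metis
    show "\<exists>\<gamma>. gauge \<gamma> \<and> (\<forall>\<D>. \<D> tagged_division_of {a..b} \<and> \<gamma> fine \<D> \<longrightarrow>
            norm ((\<Sum>(x, K)\<in>\<D>. measure lborel K *\<^sub>R \<phi>0 x) - (v b - v a)) < \<epsilon>)"
    proof (intro exI[of _ "\<lambda>x. ball x (d x)"] conjI allI impI; (elim conjE)?)
      show "gauge (\<lambda>x. ball x (d x))"
        using d(1) gauge_ball_dependent by blast
      fix p
      assume p: "p tagged_division_of {a..b}" and fine: "(\<lambda>x. ball x (d x)) fine p"
      define pN where "pN = {(x, K) \<in> p. x \<in> N}"
      have finp: "finite p" using p by (rule tagged_division_of_finite)
      have pN_sub: "pN \<subseteq> p" by (auto simp: pN_def split: if_splits)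
      have pN_tag: "pN tagged_partial_division_of {a..b}"
        using p pN_sub tagged_partial_division_subset unfolding tagged_division_of_def by blast
      define \<D> where "\<D> = snd ` pN"
      have \<D>: "\<D> division_of \<Union>\<D>"
        unfolding \<D>_def by (rule partial_division_of_tagged_division[OF pN_tag])
      have D_sub: "\<Union>\<D> \<subseteq> {a..b}"
        using pN_tag unfolding \<D>_def tagged_partial_division_of_def by force
      have D_U: "\<Union>\<D> \<subseteq> U"
        using fine d(3) by (fastforce simp: \<D>_def pN_def fine_def)
      have len: "Sup K - Inf K = measure lebesgue K" if K: "K \<in> \<D>" for K
      proof -
        obtain l r where "K = {l..r}" "K \<noteq> {}"
          using division_ofD(3,4)[OF \<D> K] by (metis box_real(2))
        then show ?thesis by simp
      qed
      \<comment> \<open>The intervals do not overlap and lie in \<open>U\<close>, so their total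
        length is below \<open>\<delta>\<close> and absolute continuity applies.\<close>
      have "(\<Sum>K\<in>\<D>. Sup K - Inf K) = measure lebesgue (\<Union>\<D>)"
        unfolding content_division[OF \<D>, symmetric] by (rule sum.cong[OF refl len])
      also have "\<dots> \<le> measure lebesgue U"
        using D_U Um lmeasurable_division[OF \<D>] by (intro measure_mono_fmeasurable) (auto simp: fmeasurableD)
      also note U_less
      finally have small: "(\<Sum>K\<in>\<D>. \<bar>v (Sup K) - v (Inf K)\<bar>) < \<epsilon> / 2"
        by (intro \<delta>(2) \<D> D_sub)
      \<comment> \<open>The case split makes the summand vanish on empty intervals, where \<open>Sup\<close> and \<open>Inf\<close> are junk.\<close>
      define h where "h K = (if K = {} then 0 else \<bar>v (Sup K) - v (Inf K)\<bar>)" for K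
      \<comment> \<open>Different tags can share an interval only if its interior is empty;
        \<open>h\<close> is 0 there, so passing from tagged pairs to intervals loses
        nothing.\<close>
      have "(\<Sum>(x, K)\<in>pN. h K) = (\<Sum>K\<in>\<D>. h K)"
        unfolding \<D>_def
      proof (rule sum.over_tagged_division_lemma[OF tagged_partial_division_of_Union_self[OF pN_tag]])
        fix u w :: real
        assume "box u w = {}"
        then show "h (cbox u w) = 0"
          by (cases "u = w") (auto simp: h_def)
      qed
      moreover have "(\<Sum>(x, K)\<in>pN. h K) = (\<Sum>(x, K)\<in>pN. \<bar>v (Sup K) - v (Inf K)\<bar>)"
        using tagged_partial_division_ofD(2)[OF pN_tag] by (intro sum.cong) (force simp: h_def)+
      moreover have "(\<Sum>K\<in>\<D>. h K) = (\<Sum>K\<in>\<D>. \<bar>v (Sup K) - v (Inf K)\<bar>)"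
        using division_ofD(3)[OF \<D>] by (intro sum.cong) (auto simp: h_def)
      ultimately have "(\<Sum>(x, K)\<in>pN. \<bar>v (Sup K) - v (Inf K)\<bar>) = (\<Sum>K\<in>\<D>. \<bar>v (Sup K) - v (Inf K)\<bar>)"
        by simp
      with small have smallN: "(\<Sum>(x, K)\<in>pN. \<bar>v (Sup K) - v (Inf K)\<bar>) < \<epsilon> / 2"
        by simp
      have ba: "b - a = (\<Sum>(x,K)\<in>p. Sup K - Inf K)" "v b - v a = (\<Sum>(x,K)\<in>p. v (Sup K) - v (Inf K))"
        using additive_tagged_division_1[OF \<open>a \<le> b\<close> p, of "\<lambda>x. x"]
              additive_tagged_division_1[OF \<open>a \<le> b\<close> p, of v] by auto
      have piece: "\<bar>measure lborel K * \<phi>0 x - (v (Sup K) - v (Inf K))\<bar>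
          \<le> \<eta> * (Sup K - Inf K) + (if x \<in> N then \<bar>v (Sup K) - v (Inf K)\<bar> else 0)"
        if xK: "(x, K) \<in> p" for x K
      proof -
        have "x \<in> K" and Kab: "K \<subseteq> {a..b}" using p xK by blast+
        then obtain l r where K: "K = {l..r}"
          using p xK by (metis box_real(2) tagged_division_ofD(4))
        then have "l \<le> x" "x \<le> r" "l \<le> r" using \<open>x \<in> K\<close> by auto
        have lr: "l \<in> {a..b}" "r \<in> {a..b}" "x \<in> {a..b}" using Kab \<open>x \<in> K\<close> \<open>l \<le> r\<close> K by auto
        show ?thesis
        proof (cases "x \<in> N")
          case True
          then show ?thesis using K \<open>l \<le> r\<close> \<eta> by (simp add: \<phi>0_def abs_minus_commute)
        next
          case False
          have "K \<subseteq> ball x (d x)" using fine xK by (auto simp: fine_def)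
          then have "l \<in> ball x (d x)" "r \<in> ball x (d x)" using K \<open>l \<le> r\<close> by auto
          then have "\<bar>l - x\<bar> < d x" "\<bar>r - x\<bar> < d x"
            by (auto simp: dist_real_def)
          with d(2)[of x l] d(2)[of x r] lr False
          have "\<bar>v l - v x - \<phi> x * (l - x)\<bar> \<le> \<eta> * \<bar>l - x\<bar>" "\<bar>v r - v x - \<phi> x * (r - x)\<bar> \<le> \<eta> * \<bar>r - x\<bar>"
            by auto
          \<comment> \<open>The tag lies between the endpoints, so the two errors add up to a
            multiple of \<open>r - l\<close>.\<close>
          then have "\<bar>v l - v x - \<phi> x * (l - x)\<bar> \<le> \<eta> * (x - l)" "\<bar>v r - v x - \<phi> x * (r - x)\<bar> \<le> \<eta> * (r - x)"
            using \<open>l \<le> x\<close> \<open>x \<le> r\<close> by auto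
          then have "\<bar>(r - l) * \<phi> x - (v r - v l)\<bar> \<le> \<eta> * (r - l)"
            by (simp add: algebra_simps abs_le_iff)
          then show ?thesis using False K \<open>l \<le> r\<close> by (simp add: \<phi>0_def)
        qed
      qed
      have "norm ((\<Sum>(x, K)\<in>p. measure lborel K *\<^sub>R \<phi>0 x) - (v b - v a))
          = \<bar>\<Sum>(x, K)\<in>p. measure lborel K * \<phi>0 x - (v (Sup K) - v (Inf K))\<bar>"
        by (simp add: ba(2) split_def sum_subtractf)
      also have "\<dots> \<le> (\<Sum>(x, K)\<in>p. \<eta> * (Sup K - Inf K) + (if x \<in> N then \<bar>v (Sup K) - v (Inf K)\<bar> else 0))"
        by (rule order_trans[OF sum_abs], rule sum_mono) (use piece in auto)
      also have "\<dots> = \<eta> * (b - a) + (\<Sum>(x, K)\<in>p. if x \<in> N then \<bar>v (Sup K) - v (Inf K)\<bar> else 0)"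
        by (simp add: ba(1) split_def sum.distrib sum_distrib_left)
      also have "(\<Sum>(x, K)\<in>p. if x \<in> N then \<bar>v (Sup K) - v (Inf K)\<bar> else 0)
          = (\<Sum>(x, K)\<in>pN. \<bar>v (Sup K) - v (Inf K)\<bar>)"
        by (rule sum.mono_neutral_cong_right[OF finp pN_sub]) (auto simp: pN_def split: if_splits)
      finally show "norm ((\<Sum>(x, K)\<in>p. measure lborel K *\<^sub>R \<phi>0 x) - (v b - v a)) < \<epsilon>"
        using smallN \<eta>_le by linarith
    qed
  qed
  then show ?thesis
    by (rule has_integral_spike[OF N, rotated]) (simp add: \<phi>0_def)
qed

section \<open>Second differences and their averages\<close>

definition second_difference :: "(real \<Rightarrow> real) \<Rightarrow> real \<Rightarrow> real \<Rightarrow> real \<Rightarrow> real" where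
  "second_difference h \<theta>1 \<theta>2 t = h t - h (t - \<theta>1) - h (t - \<theta>2) + h (t - \<theta>1 - \<theta>2)"

text \<open>Antiderivatives on the whole line let the shifts by 1 and 2 be taken without side
  conditions.\<close>

lemma antiderivative_exists:
  fixes f :: "real \<Rightarrow> real"
  assumes "\<And>t. isCont f t"
  shows "\<exists>F. \<forall>t. (F has_real_derivative f t) (at t)"
  using einterval_antiderivative[of "-\<infinity>" "\<infinity>" f] assms
  by (auto simp: has_real_derivative_iff_has_vector_derivative)

text \<open>The left-hand side is the integral of
  \<open>second_difference \<Phi> s \<theta> t\<close> over \<open>s\<close> in [0,1]. The mean
  value theorem for its primitive \<open>h\<close> shows that this average is attained, so any bound
  on second differences passes to it.\<close>

lemma second_difference_mean:
  fixes \<Phi> \<Phi>1 :: "real \<Rightarrow> real"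
  assumes \<Phi>1: "\<And>t. (\<Phi>1 has_real_derivative \<Phi> t) (at t)"
  obtains \<xi> where "\<xi> \<in> {0..1}"
    "\<Phi> t - \<Phi> (t - \<theta>) - (\<Phi>1 t - \<Phi>1 (t - 1) - \<Phi>1 (t - \<theta>) + \<Phi>1 (t - \<theta> - 1)) = second_difference \<Phi> \<xi> \<theta> t"
proof -
  define h where "h s = s * (\<Phi> t - \<Phi> (t - \<theta>)) + \<Phi>1 (t - s) - \<Phi>1 (t - \<theta> - s)" for s
  have "(h has_real_derivative second_difference \<Phi> s \<theta> t) (at s)" for s
    unfolding h_def second_difference_def
    by (auto intro!: derivative_eq_intros DERIV_chain2[OF \<Phi>1] simp: algebra_simps)
  then obtain \<xi> where "0 < \<xi>" "\<xi> < 1" "h 1 - h 0 = (1 - 0) * second_difference \<Phi> \<xi> \<theta> t"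
    using MVT2[of 0 1 h "\<lambda>s. second_difference \<Phi> s \<theta> t"] by auto
  then show ?thesis
    by (intro that[of \<xi>]) (auto simp: h_def algebra_simps)
qed

text \<open>This is the average over both steps. The mean value theorem is applied first in the
  second step, where \<open>h'\<close> is the average over the first step, and then in the first
  step.\<close>

lemma second_difference_double_mean:
  fixes \<Phi> \<Phi>1 \<Phi>2 :: "real \<Rightarrow> real"
  assumes \<Phi>1: "\<And>t. (\<Phi>1 has_real_derivative \<Phi> t) (at t)"
    and \<Phi>2: "\<And>t. (\<Phi>2 has_real_derivative \<Phi>1 t) (at t)"
  obtains \<xi> \<zeta> where "\<xi> \<in> {0..1}" "\<zeta> \<in> {0..1}"
    "\<Phi> t - 2 * (\<Phi>1 t - \<Phi>1 (t - 1)) + \<Phi>2 t - 2 * \<Phi>2 (t - 1) + \<Phi>2 (t - 2) = second_difference \<Phi> \<xi> \<zeta> t"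
proof -
  define h where "h s = s * (\<Phi> t - (\<Phi>1 t - \<Phi>1 (t - 1))) + \<Phi>1 (t - s) - \<Phi>2 (t - s) + \<Phi>2 (t - 1 - s)" for s
  define h' where "h' s = \<Phi> t - \<Phi> (t - s) - (\<Phi>1 t - \<Phi>1 (t - 1) - \<Phi>1 (t - s) + \<Phi>1 (t - s - 1))" for s
  have "(h has_real_derivative h' s) (at s)" for s
    unfolding h_def h'_def
    by (auto intro!: derivative_eq_intros DERIV_chain2[OF \<Phi>1] DERIV_chain2[OF \<Phi>2] simp: algebra_simps)
  then obtain \<zeta> where \<zeta>: "0 < \<zeta>" "\<zeta> < 1" "h 1 - h 0 = (1 - 0) * h' \<zeta>"
    using MVT2[of 0 1 h h'] by auto
  obtain \<xi> where "\<xi> \<in> {0..1}" "h' \<zeta> = second_difference \<Phi> \<xi> \<zeta> t"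
    using second_difference_mean[OF \<Phi>1] unfolding h'_def by blast
  with \<zeta> show ?thesis
    by (intro that[of \<xi> \<zeta>]) (auto simp: h_def algebra_simps)
qed

section \<open>Lyapunov estimate for the damped system\<close>

text \<open>Gronwall argument: with the integrating factor \<open>exp (c * t)\<close>, the function
  \<open>G\<close> is nonincreasing, so the excess of \<open>V\<close> over \<open>L / c\<close> is
  at most \<open>G T * exp (- (c * t))\<close>, which tends to 0.\<close>

lemma eventually_le_of_linear_decay:
  fixes V V' :: "real \<Rightarrow> real"
  assumes V: "\<And>t. t \<ge> T \<Longrightarrow> (V has_real_derivative V' t) (at t)"
    and V': "\<And>t. t \<ge> T \<Longrightarrow> V' t \<le> - c * V t + L"
    and "c > 0" "e > 0"
  shows "\<forall>\<^sub>F t in at_top. V t \<le> L / c + e"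
proof -
  define G where "G t = exp (c * t) * (V t - L / c)" for t
  have mono: "G t \<le> G T" if "t \<ge> T" for t
  proof (rule DERIV_nonpos_imp_nonincreasing[OF that])
    fix s assume "T \<le> s" "s \<le> t"
    have "(G has_real_derivative exp (c * s) * (V' s + c * V s - L)) (at s)"
      unfolding G_def using V[OF \<open>T \<le> s\<close>] \<open>c > 0\<close>
      by (auto intro!: derivative_eq_intros simp: field_simps)
    moreover have "exp (c * s) * (V' s + c * V s - L) \<le> 0"
      using V'[OF \<open>T \<le> s\<close>] by (intro mult_nonneg_nonpos) auto
    ultimately show "\<exists>y. (G has_real_derivative y) (at s) \<and> y \<le> 0" by blast
  qed
  have "((\<lambda>t. G T * exp (- (c * t))) \<longlongrightarrow> G T * 0) at_top"
  proof (intro tendsto_intros filterlim_compose[OF exp_at_bot])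
    show "LIM t at_top. - (c * t) :> at_bot"
      using filterlim_tendsto_pos_mult_at_top[OF tendsto_const \<open>c > 0\<close> filterlim_ident]
      by (simp add: filterlim_uminus_at_top)
  qed
  then have "\<forall>\<^sub>F t in at_top. G T * exp (- (c * t)) < e"
    using \<open>e > 0\<close> by (auto dest: order_tendstoD(2))
  then show ?thesis
    using eventually_ge_at_top[of T]
  proof eventually_elim
    case (elim t)
    have "V t - L / c = G t * exp (- (c * t))"
      by (simp add: G_def exp_minus)
    also have "\<dots> \<le> G T * exp (- (c * t))"
      using mono elim(2) by simp
    finally show ?case using elim(1) by simp
  qed
qed

text \<open>The weight \<open>k\<close> is free so that the square of \<open>u\<close> can be
  absorbed into a given amount of dissipation.\<close>

lemma young_inequality: "k > 0 \<Longrightarrow> u * r \<le> k / 2 * u\<^sup>2 + r\<^sup>2 / (2 * k)" for k u r :: real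
proof -
  assume k: "k > 0"
  have "0 \<le> (k * u - r)\<^sup>2 / (2 * k)" using k by simp
  also have "\<dots> = k / 2 * u\<^sup>2 + r\<^sup>2 / (2 * k) - u * r"
    using k by (simp add: field_simps power2_eq_square)
  finally show ?thesis by simp
qed

text \<open>Without \<open>p\<close> and \<open>q\<close> this is
  \<open>u'' + a u' + b u = 0\<close> in Lienard coordinates. Exponential decay removes the initial
  data, and the inputs enter the estimate of \<open>V'\<close> as a multiple of the square of
  \<open>M\<close>, so the bound on \<open>u\<close> is linear in \<open>M\<close> with a constant
  chosen before the functions, \<open>T\<close> and \<open>M\<close>.\<close>

lemma damped_system_eventually_bounded:
  fixes a b :: real
  assumes "a > 0" "b > 0"
  obtains C where "C > 0"
    "\<And>u w p q T M. \<lbrakk>\<And>t. t \<ge> T \<Longrightarrow> (u has_real_derivative w t - a * u t + p t) (at t);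
       \<And>t. t \<ge> T \<Longrightarrow> (w has_real_derivative q t - b * u t) (at t);
       \<And>t. t \<ge> T \<Longrightarrow> \<bar>p t\<bar> \<le> M; \<And>t. t \<ge> T \<Longrightarrow> \<bar>q t\<bar> \<le> M; M > 0\<rbrakk>
       \<Longrightarrow> \<forall>\<^sub>F t in at_top. \<bar>u t\<bar> \<le> C * M"
proof -
  \<comment> \<open>The bounds \<open>b / 2\<close> and \<open>1 / 2\<close> make the cross term at
    most half the energy; the third lets \<open>a * b\<close> absorb the \<open>u\<close> terms that
    the cross term adds to \<open>V'\<close>.\<close>
  define \<epsilon> where "\<epsilon> = min (min (b / 2) (1 / 2)) (a * b / (2 * b + a\<^sup>2))"
  have den: "2 * b + a\<^sup>2 > 0" using assms by (simp add: add_pos_nonneg)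
  have \<epsilon>: "\<epsilon> > 0" "\<epsilon> \<le> b / 2" "\<epsilon> \<le> 1 / 2"
    using assms den unfolding \<epsilon>_def by (simp, linarith, linarith)
  have "\<epsilon> \<le> a * b / (2 * b + a\<^sup>2)" by (simp add: \<epsilon>_def)
  then have \<epsilon>4: "\<epsilon> * (2 * b + a\<^sup>2) \<le> a * b" using den by (simp add: pos_le_divide_eq)
  \<comment> \<open>Since \<open>V\<close> is at most 3/2 of the energy, these thirds make
    \<open>c * V\<close> at most the half of the dissipation left at the end.\<close>
  define c where "c = min (a / 3) (\<epsilon> / 3)"
  have c: "c > 0" "c \<le> a / 3" "c \<le> \<epsilon> / 3" using assms \<epsilon> unfolding c_def by (simp, linarith, linarith)
  \<comment> \<open>The two quotients are the remainders of Young's inequality with weights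
    \<open>a * b\<close> and \<open>\<epsilon>\<close>.\<close>
  define K where "K = (2 * b + 2 * \<epsilon>)\<^sup>2 / (2 * (a * b)) + (2 + 2 * \<epsilon>)\<^sup>2 / (2 * \<epsilon>)"
  have K: "K \<ge> 0" using assms \<epsilon> by (simp add: K_def)
  \<comment> \<open>This solves \<open>b / 2 * u\<^sup>2 \<le> (K / c + 1) * M\<^sup>2\<close> for
    \<open>u\<close>; the 1 comes from the tolerance \<open>M\<^sup>2\<close> in the decay
    lemma.\<close>
  define C where "C = sqrt (2 / b * (K / c + 1))"
  have arg: "2 / b * (K / c + 1) > 0" using assms K c by (simp add: add_nonneg_pos)
  show ?thesis
  proof (rule that[of C])
    show "C > 0" using arg by (simp add: C_def)
  next
    fix u w p q :: "real \<Rightarrow> real" and T M :: real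
    assume u: "\<And>t. t \<ge> T \<Longrightarrow> (u has_real_derivative w t - a * u t + p t) (at t)"
      and w: "\<And>t. t \<ge> T \<Longrightarrow> (w has_real_derivative q t - b * u t) (at t)"
      and p: "\<And>t. t \<ge> T \<Longrightarrow> \<bar>p t\<bar> \<le> M" and q: "\<And>t. t \<ge> T \<Longrightarrow> \<bar>q t\<bar> \<le> M" and "M > 0"
    \<comment> \<open>Lyapunov function: the energy \<open>b u\<^sup>2 + w\<^sup>2\<close> alone dissipates only through \<open>u\<close>;
      the small cross term makes \<open>V'\<close> negative definite.\<close>
    define V where "V t = b * (u t)\<^sup>2 + (w t)\<^sup>2 - 2 * \<epsilon> * (u t * w t)" for t
    define V' where "V' t = - 2 * (a * b * (u t)\<^sup>2) - 2 * (\<epsilon> * (w t)\<^sup>2) + 2 * \<epsilon> * b * (u t)\<^sup>2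
        + 2 * \<epsilon> * a * (u t * w t) + u t * (2 * b * p t - 2 * \<epsilon> * q t) + w t * (2 * q t - 2 * \<epsilon> * p t)" for t
    have uw: "\<bar>2 * \<epsilon> * (u t * w t)\<bar> \<le> b / 2 * (u t)\<^sup>2 + 1 / 2 * (w t)\<^sup>2" for t
    proof -
      have "\<bar>2 * (u t * w t)\<bar> \<le> (u t)\<^sup>2 + (w t)\<^sup>2"
        using sum_squares_bound[of "u t" "w t"] sum_squares_bound[of "- u t" "w t"] by (simp add: abs_le_iff)
      then have "\<epsilon> * \<bar>2 * (u t * w t)\<bar> \<le> \<epsilon> * ((u t)\<^sup>2 + (w t)\<^sup>2)"
        using \<epsilon> by (intro mult_left_mono) auto
      also have "\<dots> \<le> b / 2 * (u t)\<^sup>2 + 1 / 2 * (w t)\<^sup>2"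
        using \<epsilon> by (auto simp: distrib_left intro!: add_mono mult_right_mono[of \<epsilon> "b/2", simplified] mult_right_mono[of \<epsilon> "1/2", simplified])
      finally show ?thesis using \<epsilon> by (simp add: abs_mult)
    qed
    have "\<forall>\<^sub>F t in at_top. V t \<le> K * M\<^sup>2 / c + M\<^sup>2"
    proof (rule eventually_le_of_linear_decay)
      fix t assume "t \<ge> T"
      show "(V has_real_derivative V' t) (at t)"
        unfolding V_def V'_def using u[OF \<open>t \<ge> T\<close>] w[OF \<open>t \<ge> T\<close>]
        by (auto intro!: derivative_eq_intros simp: algebra_simps power2_eq_square)
      have r1: "u t * (2 * b * p t - 2 * \<epsilon> * q t) \<le> (a * b * (u t)\<^sup>2) / 2 + ((2 * b + 2 * \<epsilon>) * M)\<^sup>2 / (2 * (a * b))"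
      proof -
        have "\<bar>2 * b * p t - 2 * \<epsilon> * q t\<bar> \<le> 2 * b * \<bar>p t\<bar> + 2 * \<epsilon> * \<bar>q t\<bar>"
          using assms \<epsilon> by (intro order_trans[OF abs_triangle_ineq4]) (simp add: abs_mult)
        also have "\<dots> \<le> 2 * b * M + 2 * \<epsilon> * M"
          using assms \<epsilon> p[OF \<open>t \<ge> T\<close>] q[OF \<open>t \<ge> T\<close>] by (intro add_mono mult_left_mono) auto
        finally have "(2 * b * p t - 2 * \<epsilon> * q t)\<^sup>2 \<le> ((2 * b + 2 * \<epsilon>) * M)\<^sup>2"
          by (intro abs_le_square_iff[THEN iffD1]) (simp add: algebra_simps)
        then have "(2 * b * p t - 2 * \<epsilon> * q t)\<^sup>2 / (2 * (a * b)) \<le> ((2 * b + 2 * \<epsilon>) * M)\<^sup>2 / (2 * (a * b))"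
          using assms by (intro divide_right_mono) auto
        with young_inequality[of "a * b" "u t" "2 * b * p t - 2 * \<epsilon> * q t"] assms show ?thesis by simp
      qed
      have r2: "w t * (2 * q t - 2 * \<epsilon> * p t) \<le> (\<epsilon> * (w t)\<^sup>2) / 2 + ((2 + 2 * \<epsilon>) * M)\<^sup>2 / (2 * \<epsilon>)"
      proof -
        have "\<bar>2 * q t - 2 * \<epsilon> * p t\<bar> \<le> 2 * \<bar>q t\<bar> + 2 * \<epsilon> * \<bar>p t\<bar>"
          using \<epsilon> by (intro order_trans[OF abs_triangle_ineq4]) (simp add: abs_mult)
        also have "\<dots> \<le> 2 * M + 2 * \<epsilon> * M"
          using \<epsilon> p[OF \<open>t \<ge> T\<close>] q[OF \<open>t \<ge> T\<close>] by (intro add_mono mult_left_mono) auto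
        finally have "(2 * q t - 2 * \<epsilon> * p t)\<^sup>2 \<le> ((2 + 2 * \<epsilon>) * M)\<^sup>2"
          by (intro abs_le_square_iff[THEN iffD1]) (simp add: algebra_simps)
        then have "(2 * q t - 2 * \<epsilon> * p t)\<^sup>2 / (2 * \<epsilon>) \<le> ((2 + 2 * \<epsilon>) * M)\<^sup>2 / (2 * \<epsilon>)"
          using \<epsilon> by (intro divide_right_mono) auto
        with young_inequality[of \<epsilon> "w t" "2 * q t - 2 * \<epsilon> * p t"] \<epsilon> show ?thesis by simp
      qed
      have r3: "2 * \<epsilon> * a * (u t * w t) \<le> \<epsilon> * a\<^sup>2 * (u t)\<^sup>2 + \<epsilon> * (w t)\<^sup>2"
      proof -
        have "0 \<le> \<epsilon> * (a * u t - w t)\<^sup>2" using \<epsilon> by simp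
        then show ?thesis by (simp add: power2_eq_square algebra_simps)
      qed
      have r4: "2 * \<epsilon> * b * (u t)\<^sup>2 + \<epsilon> * a\<^sup>2 * (u t)\<^sup>2 \<le> a * b * (u t)\<^sup>2"
        using mult_right_mono[OF \<epsilon>4, of "(u t)\<^sup>2"] by (simp add: algebra_simps)
      have KM: "K * M\<^sup>2 = ((2 * b + 2 * \<epsilon>) * M)\<^sup>2 / (2 * (a * b)) + ((2 + 2 * \<epsilon>) * M)\<^sup>2 / (2 * \<epsilon>)"
        unfolding K_def power_mult_distrib by (simp add: distrib_right[of _ _ "M\<^sup>2"])
      \<comment> \<open>Budget of the dissipation: of \<open>2 * U\<close>, one \<open>U\<close>
        pays for \<open>Z + Y\<close> and half a \<open>U\<close> for \<open>P1\<close>; of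
        \<open>2 * W\<close>, one \<open>W\<close> pays for the rest of \<open>X\<close> and half a
        \<open>W\<close> for \<open>P2\<close>. Half of each remains.\<close>
      have "- 2 * U - 2 * W + Z + X + P1 + P2 \<le> - U / 2 - W / 2 + (A1 + A2)"
        if "P1 \<le> U / 2 + A1" "P2 \<le> W / 2 + A2" "X \<le> Y + W" "Z + Y \<le> U"
        for P1 P2 A1 A2 U W X Y Z :: real
        using that by linarith
      from this[OF r1 r2 r3 r4]
      have "V' t \<le> - (a * b * (u t)\<^sup>2) / 2 - (\<epsilon> * (w t)\<^sup>2) / 2 + K * M\<^sup>2"
        unfolding V'_def KM .
      moreover have "c * V t \<le> (a * b * (u t)\<^sup>2) / 2 + (\<epsilon> * (w t)\<^sup>2) / 2"
      proof -
        have "V t \<le> 3 / 2 * (b * (u t)\<^sup>2) + 3 / 2 * (w t)\<^sup>2"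
          using uw[of t] unfolding V_def by linarith
        then have "c * V t \<le> c * (3 / 2 * (b * (u t)\<^sup>2) + 3 / 2 * (w t)\<^sup>2)"
          using c by (intro mult_left_mono) auto
        also have "\<dots> = c * (3 / 2 * (b * (u t)\<^sup>2)) + c * (3 / 2 * (w t)\<^sup>2)"
          by (simp add: distrib_left)
        also have "\<dots> \<le> a / 3 * (3 / 2 * (b * (u t)\<^sup>2)) + \<epsilon> / 3 * (3 / 2 * (w t)\<^sup>2)"
          using c assms by (intro add_mono mult_right_mono) auto
        finally show ?thesis by simp
      qed
      ultimately show "V' t \<le> - c * V t + K * M\<^sup>2" by simp
    qed (use c \<open>M > 0\<close> in auto)
    then show "\<forall>\<^sub>F t in at_top. \<bar>u t\<bar> \<le> C * M"
    proof eventually_elim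
      case (elim t)
      have "b / 2 * (u t)\<^sup>2 \<le> V t"
        using uw[of t] zero_le_power2[of "w t"] unfolding V_def by linarith
      moreover have "K * M\<^sup>2 / c + M\<^sup>2 = (K / c + 1) * M\<^sup>2" by (simp add: algebra_simps)
      ultimately have "b / 2 * (u t)\<^sup>2 \<le> (K / c + 1) * M\<^sup>2" using elim by linarith
      then have "(u t)\<^sup>2 \<le> (2 / b * (K / c + 1)) * M\<^sup>2" using assms by (simp add: field_simps)
      also have "\<dots> = (C * M)\<^sup>2" using arg by (simp add: C_def power_mult_distrib)
      finally have "\<bar>u t\<bar> \<le> \<bar>C * M\<bar>" by (simp add: abs_le_square_iff)
      then show ?case using \<open>M > 0\<close> arg by (simp add: C_def abs_mult)
    qed
  qed
qed

section \<open>Mutual bounds between the response and second differences\<close>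

text \<open>Hypothesis \<open>eq\<close> is the equation integrated once, with \<open>g\<close> an
  antiderivative of the forcing. Only the combination \<open>v + a x - g\<close> is differentiated,
  never \<open>v\<close> or \<open>g\<close> alone. \<open>C\<close> precedes \<open>T\<close> and
  \<open>M\<close>, which makes the bound usable for limsups.\<close>

lemma response_bounded_by_second_differences:
  fixes a b :: real
  assumes "a > 0" "b > 0"
    and x: "\<And>t. t > 0 \<Longrightarrow> (x has_real_derivative v t) (at t)"
    and \<Phi>: "\<And>t. (\<Phi> has_real_derivative g t) (at t)"
    and eq: "\<And>t. t > 0 \<Longrightarrow> ((\<lambda>t. v t + a * x t - g t) has_real_derivative - b * x t) (at t)"
  obtains C where "C > 0"
    "\<And>T M. \<lbrakk>\<And>t \<theta>1 \<theta>2. \<lbrakk>t \<ge> T; \<theta>1 \<in> {0..1}; \<theta>2 \<in> {0..1}\<rbrakk> \<Longrightarrow> \<bar>second_difference \<Phi> \<theta>1 \<theta>2 t\<bar> \<le> M; M > 0\<rbrakk>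
       \<Longrightarrow> \<forall>\<^sub>F t in at_top. \<bar>x t\<bar> \<le> C * M"
proof -
  obtain C where C: "C > 0"
    "\<And>u w p q T M. \<lbrakk>\<And>t. t \<ge> T \<Longrightarrow> (u has_real_derivative w t - a * u t + p t) (at t);
       \<And>t. t \<ge> T \<Longrightarrow> (w has_real_derivative q t - b * u t) (at t);
       \<And>t. t \<ge> T \<Longrightarrow> \<bar>p t\<bar> \<le> M; \<And>t. t \<ge> T \<Longrightarrow> \<bar>q t\<bar> \<le> M; M > 0\<rbrakk>
       \<Longrightarrow> \<forall>\<^sub>F t in at_top. \<bar>u t\<bar> \<le> C * M"
    using damped_system_eventually_bounded[OF assms(1,2)] by blast
  show ?thesis
  \<comment> \<open>The factor \<open>a + b + 2\<close> covers both inputs of the system, and the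
    final 1 pays for \<open>Q\<close> in \<open>x = u + Q\<close>.\<close>
  proof (rule that[of "C * (a + b + 2) + 1"])
    show "C * (a + b + 2) + 1 > 0" using C(1) assms(1,2) by (simp add: add_pos_pos)
  next
    fix T M :: real
    assume bd: "\<And>t \<theta>1 \<theta>2. \<lbrakk>t \<ge> T; \<theta>1 \<in> {0..1}; \<theta>2 \<in> {0..1}\<rbrakk> \<Longrightarrow> \<bar>second_difference \<Phi> \<theta>1 \<theta>2 t\<bar> \<le> M"
      and "M > 0"
    obtain \<Phi>1 where \<Phi>1: "\<And>t. (\<Phi>1 has_real_derivative \<Phi> t) (at t)"
      using antiderivative_exists[OF DERIV_isCont[OF \<Phi>]] by blast
    obtain \<Phi>2 where \<Phi>2: "\<And>t. (\<Phi>2 has_real_derivative \<Phi>1 t) (at t)"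
      using antiderivative_exists[OF DERIV_isCont[OF \<Phi>1]] by blast
    \<comment> \<open>\<open>Q\<close> averages over both steps and \<open>R\<close> over the first
      with the second equal to 1. Here \<open>Q' = g - 2 R - E\<close>, so subtracting
      \<open>Q\<close> from \<open>x\<close> trades \<open>g\<close> for bounded terms and
      \<open>E\<close>.\<close>
    define Q where "Q t = \<Phi> t - 2 * (\<Phi>1 t - \<Phi>1 (t - 1)) + \<Phi>2 t - 2 * \<Phi>2 (t - 1) + \<Phi>2 (t - 2)" for t
    define E where "E t = \<Phi>1 t - 2 * \<Phi>1 (t - 1) + \<Phi>1 (t - 2)" for t
    define R where "R t = \<Phi> t - \<Phi> (t - 1) - E t" for t
    define u where "u t = x t - Q t" for t
    \<comment> \<open>Including \<open>E\<close> cancels it from \<open>u'\<close>, at the cost of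
      \<open>E'\<close> in \<open>w'\<close>, which is the second difference with both steps
      1.\<close>
    define w where "w t = v t + a * x t - g t + E t" for t
    have Q: "\<bar>Q t\<bar> \<le> M" if "t \<ge> T" for t
      using second_difference_double_mean[OF \<Phi>1 \<Phi>2, of t] bd[OF that] unfolding Q_def by metis
    have R: "\<bar>R t\<bar> \<le> M" if "t \<ge> T" for t
    proof -
      obtain \<xi> where "\<xi> \<in> {0..1}" "R t = second_difference \<Phi> \<xi> 1 t"
        using second_difference_mean[OF \<Phi>1, of t 1] unfolding R_def E_def by (auto simp: algebra_simps)
      then show ?thesis using bd[OF that] by auto
    qed
    define S where "S = max T 1"
    have "\<forall>\<^sub>F t in at_top. \<bar>u t\<bar> \<le> C * ((a + b + 2) * M)"
    proof (rule C(2)[where p = "\<lambda>t. 2 * R t - a * Q t" and q = "\<lambda>t. second_difference \<Phi> 1 1 t - b * Q t" and T = S])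
      fix t assume "t \<ge> S"
      then have t: "t \<ge> T" "t > 0" by (auto simp: S_def)
      show "(u has_real_derivative w t - a * u t + (2 * R t - a * Q t)) (at t)"
        unfolding u_def Q_def w_def R_def E_def
        by (auto intro!: derivative_eq_intros x[OF t(2)] \<Phi> DERIV_chain2[OF \<Phi>1] DERIV_chain2[OF \<Phi>2] simp: algebra_simps)
      have "(E has_real_derivative second_difference \<Phi> 1 1 t) (at t)"
        unfolding E_def second_difference_def
        by (auto intro!: derivative_eq_intros DERIV_chain2[OF \<Phi>1] simp: algebra_simps)
      from DERIV_add[OF eq[OF t(2)] this]
      show "(w has_real_derivative second_difference \<Phi> 1 1 t - b * Q t - b * u t) (at t)"
        unfolding w_def u_def by (simp add: algebra_simps)
      have "\<bar>a * Q t\<bar> \<le> a * M" "\<bar>b * Q t\<bar> \<le> b * M"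
        using assms(1,2) Q[OF t(1)] by (auto simp: abs_mult)
      moreover have "\<bar>second_difference \<Phi> 1 1 t\<bar> \<le> M" using bd[OF t(1)] by auto
      moreover have "0 \<le> a * M" "0 \<le> b * M" using assms(1,2) \<open>M > 0\<close> by auto
      ultimately show "\<bar>2 * R t - a * Q t\<bar> \<le> (a + b + 2) * M"
        "\<bar>second_difference \<Phi> 1 1 t - b * Q t\<bar> \<le> (a + b + 2) * M"
        using R[OF t(1)] \<open>M > 0\<close> by (simp_all add: distrib_right)
    qed (use assms(1,2) \<open>M > 0\<close> in auto)
    then show "\<forall>\<^sub>F t in at_top. \<bar>x t\<bar> \<le> (C * (a + b + 2) + 1) * M"
      using eventually_ge_at_top[of T]
    proof eventually_elim
      case (elim t)
      have "\<bar>x t\<bar> \<le> \<bar>u t\<bar> + \<bar>Q t\<bar>" unfolding u_def by linarith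
      also have "\<dots> \<le> C * ((a + b + 2) * M) + M" using elim Q by (intro add_mono) auto
      finally show ?case by (simp add: algebra_simps)
    qed
  qed
qed

text \<open>The constant counts four values of \<open>x\<close>, two increments of the
  \<open>N\<close>-Lipschitz function \<open>X1\<close> over steps at most 1, and one twofold
  integral of \<open>x\<close>. Starting at \<open>T + 2\<close> keeps all shifted arguments at or
  beyond \<open>T\<close>.\<close>

lemma second_difference_bounded_by_response:
  fixes a b :: real
  assumes "a > 0" "b > 0" "T > 0"
    and x: "\<And>t. t > 0 \<Longrightarrow> (x has_real_derivative v t) (at t)"
    and \<Phi>: "\<And>t. t > 0 \<Longrightarrow> (\<Phi> has_real_derivative g t) (at t)"
    and eq: "\<And>t. t > 0 \<Longrightarrow> ((\<lambda>t. v t + a * x t - g t) has_real_derivative - b * x t) (at t)"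
    and bd: "\<And>t. t \<ge> T \<Longrightarrow> \<bar>x t\<bar> \<le> N"
    and t: "t \<ge> T + 2" and \<theta>: "\<theta>1 \<in> {0..1}" "\<theta>2 \<in> {0..1}"
  shows "\<bar>second_difference \<Phi> \<theta>1 \<theta>2 t\<bar> \<le> (4 + 2 * a + b) * N"
proof -
  \<comment> \<open>The equation makes \<open>X1\<close>, \<open>X2\<close> first and second antiderivatives of \<open>x\<close>
    with \<open>\<Phi> = x + a X1 + b X2\<close>.\<close>
  define X1 where "X1 t = - (v t + a * x t - g t) / b" for t
  define X2 where "X2 t = (\<Phi> t - x t - a * X1 t) / b" for t
  have X1: "(X1 has_real_derivative x t) (at t)" if "t > 0" for t
    using DERIV_cdivide[OF DERIV_minus[OF eq[OF that]], of b] \<open>b > 0\<close> by (simp add: X1_def[abs_def])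
  have X2: "(X2 has_real_derivative X1 t) (at t)" if "t > 0" for t
    unfolding X2_def using \<open>b > 0\<close>
    by (auto intro!: derivative_eq_intros x[OF that] \<Phi>[OF that] X1[OF that]) (simp add: X1_def field_simps)
  have N: "N \<ge> 0" using bd[of T] by linarith
  have lip: "\<bar>X1 s - X1 r\<bar> \<le> N * \<bar>s - r\<bar>" if "s \<ge> T" "r \<ge> T" for s r
    using field_differentiable_bound[of "{T..}" X1 x N s r] that bd X1 \<open>T > 0\<close>
    by (auto simp: has_field_derivative_at_within)
  have lip1: "\<bar>X1 s - X1 (s - \<theta>1)\<bar> \<le> N" if "s \<ge> T + 1" for s
  proof -
    have "\<bar>X1 s - X1 (s - \<theta>1)\<bar> \<le> N * \<theta>1" using lip[of s "s - \<theta>1"] that \<theta> by auto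
    also have "\<dots> \<le> N * 1" using N \<theta> by (intro mult_left_mono) auto
    finally show ?thesis by simp
  qed
  have D1: "\<bar>second_difference X1 \<theta>1 \<theta>2 t\<bar> \<le> 2 * N"
    using lip1[of t] lip1[of "t - \<theta>2"] t \<theta> by (auto simp: second_difference_def algebra_simps)
  have D2: "\<bar>second_difference X2 \<theta>1 \<theta>2 t\<bar> \<le> N"
  proof -
    define k where "k s = X2 s - X2 (s - \<theta>1)" for s
    have "(k has_real_derivative X1 s - X1 (s - \<theta>1)) (at s)" if "s \<ge> T + 1" for s
      unfolding k_def using that \<theta> \<open>T > 0\<close>
      by (auto intro!: derivative_eq_intros X2 DERIV_chain2[OF X2])
    then have "\<bar>k t - k (t - \<theta>2)\<bar> \<le> N * \<bar>t - (t - \<theta>2)\<bar>"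
      using field_differentiable_bound[of "{T + 1..}" k "\<lambda>s. X1 s - X1 (s - \<theta>1)" N t "t - \<theta>2"] lip1 t \<theta>
      by (auto simp: has_field_derivative_at_within)
    also have "\<dots> \<le> N * 1" using N \<theta> by (intro mult_left_mono) auto
    finally show ?thesis by (simp add: k_def second_difference_def algebra_simps)
  qed
  have D0: "\<bar>second_difference x \<theta>1 \<theta>2 t\<bar> \<le> 4 * N"
    using bd[of t] bd[of "t - \<theta>1"] bd[of "t - \<theta>2"] bd[of "t - \<theta>1 - \<theta>2"] t \<theta>
    by (auto simp: second_difference_def)
  have "\<Phi> s = x s + a * X1 s + b * X2 s" for s
    using \<open>b > 0\<close> by (simp add: X2_def)
  then have "second_difference \<Phi> \<theta>1 \<theta>2 t = second_difference x \<theta>1 \<theta>2 t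
      + a * second_difference X1 \<theta>1 \<theta>2 t + b * second_difference X2 \<theta>1 \<theta>2 t"
    by (simp add: second_difference_def algebra_simps)
  also have "\<bar>\<dots>\<bar> \<le> \<bar>second_difference x \<theta>1 \<theta>2 t\<bar> + a * \<bar>second_difference X1 \<theta>1 \<theta>2 t\<bar>
      + b * \<bar>second_difference X2 \<theta>1 \<theta>2 t\<bar>"
    using assms(1,2) by (intro order_trans[OF abs_triangle_ineq] add_mono) (auto simp: abs_mult)
  also have "\<dots> \<le> 4 * N + a * (2 * N) + b * N"
    using D0 D1 D2 assms(1,2) by (intro add_mono mult_left_mono) auto
  finally show ?thesis by (simp add: algebra_simps)
qed

section \<open>From the definitions to antiderivatives\<close>

lemma locally_integrable_indefinite_integral_continuous:
  assumes "locally_integrable f"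
  shows "isCont (\<lambda>s. integral {0..s} f) t"
proof -
  define T where "T = \<bar>t\<bar> + 1"
  have "f absolutely_integrable_on {0..T}"
    using assms by (simp add: locally_integrable_def T_def)
  then have "f integrable_on {0..T}"
    by (rule set_lebesgue_integral_eq_integral)
  then have "continuous_on {0..T} (\<lambda>s. integral {0..s} f)"
    by (rule indefinite_integral_continuous_1)
  \<comment> \<open>Clamping with \<open>max 0 s\<close> extends continuity to negative
    \<open>s\<close>, where the interval is empty and the integral is 0.\<close>
  then have "continuous_on {..<T} (\<lambda>s. integral {0..max 0 s} f)"
    by (rule continuous_on_compose2) (auto intro!: continuous_intros simp: T_def)
  moreover have "integral {0..max 0 s} f = integral {0..s} f" for s
    by (cases "s \<ge> 0") (auto simp: max_def)
  ultimately show ?thesis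
    by (auto simp: continuous_on_eq_continuous_at T_def)
qed

text \<open>For \<open>t \<ge> 2\<close> the outer variable stays at least 1 and the inner one
  nonnegative, so no truncation at 0 occurs. Additivity of the integral handles the merely
  integrable \<open>f\<close>, the fundamental theorem the continuous outer integrand.\<close>

lemma F_avg_eq_second_difference:
  assumes f: "locally_integrable f"
    and \<Phi>: "\<And>t. (\<Phi> has_real_derivative integral {0..t} f) (at t)"
    and t: "t \<ge> 2" and \<theta>: "\<theta>1 \<in> {0..1}" "\<theta>2 \<in> {0..1}"
  shows "F_avg f \<theta>1 \<theta>2 t = second_difference \<Phi> \<theta>1 \<theta>2 t"
proof -
  define g where "g s = integral {0..s} f" for s
  have g: "isCont g s" for s
    using locally_integrable_indefinite_integral_continuous[OF f] by (simp add: g_def[abs_def])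
  have inner: "(LINT u:{max (s - \<theta>2) 0..s}|lebesgue. f u) = g s - g (s - \<theta>2)" if "s \<ge> 1" for s
  proof -
    have int: "f absolutely_integrable_on {0..s}" using f that by (auto simp: locally_integrable_def)
    then have "f absolutely_integrable_on {s - \<theta>2..s}"
      by (rule set_integrable_subset) (use that \<theta> in auto)
    then have "(LINT u:{s - \<theta>2..s}|lebesgue. f u) = integral {s - \<theta>2..s} f"
      by (rule set_lebesgue_integral_eq_integral)
    also have "\<dots> = g s - g (s - \<theta>2)"
    proof -
      have "integral {0..s - \<theta>2} f + integral {s - \<theta>2..s} f = integral {0..s} f"
        by (rule Henstock_Kurzweil_Integration.integral_combine)
          (use that \<theta> set_lebesgue_integral_eq_integral(1)[OF int] in auto)
      then show ?thesis by (simp add: g_def)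
    qed
    finally have "(LINT u:{s - \<theta>2..s}|lebesgue. f u) = g s - g (s - \<theta>2)" .
    moreover have "max (s - \<theta>2) 0 = s - \<theta>2" using that \<theta> by simp
    ultimately show ?thesis by simp
  qed
  have "max (t - \<theta>1) 0 = t - \<theta>1" using t \<theta> by simp
  then have "F_avg f \<theta>1 \<theta>2 t = (LINT s:{t - \<theta>1..t}|lebesgue. g s - g (s - \<theta>2))"
    unfolding F_avg_def using t \<theta> inner by (auto intro!: set_lebesgue_integral_cong)
  also have "\<dots> = integral {t - \<theta>1..t} (\<lambda>s. g s - g (s - \<theta>2))"
    by (intro set_lebesgue_integral_eq_integral absolutely_integrable_continuous_real
        continuous_at_imp_continuous_on ballI continuous_diff g isCont_o2[OF _ g]) auto
  also have "\<dots> = (\<Phi> t - \<Phi> (t - \<theta>2)) - (\<Phi> (t - \<theta>1) - \<Phi> (t - \<theta>1 - \<theta>2))"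
  proof (intro integral_unique fundamental_theorem_of_calculus)
    fix s
    have "((\<lambda>s. \<Phi> s - \<Phi> (s - \<theta>2)) has_real_derivative g s - g (s - \<theta>2)) (at s within {t - \<theta>1..t})"
      unfolding g_def
      by (rule has_field_derivative_at_within) (auto intro!: derivative_eq_intros \<Phi> DERIV_chain2[OF \<Phi>])
    then show "((\<lambda>s. \<Phi> s - \<Phi> (s - \<theta>2)) has_vector_derivative g s - g (s - \<theta>2)) (at s within {t - \<theta>1..t})"
      by (simp add: has_real_derivative_iff_has_vector_derivative)
  qed (use \<theta> in auto)
  finally show ?thesis by (simp add: second_difference_def)
qed

text \<open>Absolute continuity of \<open>v\<close> turns the almost everywhere equation into an
  integral identity valid at every time. Its right-hand side is differentiable everywhere because
  \<open>x\<close> is continuous.\<close>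

lemma is_solution_first_integral:
  assumes f: "locally_integrable f" and sol: "is_solution a b f \<xi>0 \<xi>1 x"
  obtains v where "\<And>t. t > 0 \<Longrightarrow> (x has_real_derivative v t) (at t)"
    "\<And>t. t > 0 \<Longrightarrow> ((\<lambda>t. v t + a * x t - integral {0..t} f) has_real_derivative - b * x t) (at t)"
proof -
  from sol obtain v where
    x: "\<And>t. t \<ge> 0 \<Longrightarrow> (x has_real_derivative v t) (at t within {0..})"
    and ac: "locally_abs_continuous v"
    and ae: "AE t in lebesgue. t \<ge> 0 \<longrightarrow>
              (\<exists>x''. (v has_real_derivative x'') (at t within {0..}) \<and> x'' + a * v t + b * x t = f t)"
    unfolding is_solution_def by blast
  obtain N where N: "negligible N"
    "\<And>t. \<lbrakk>t \<ge> 0; t \<notin> N\<rbrakk> \<Longrightarrow> (v has_real_derivative f t - a * v t - b * x t) (at t within {0..})"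
  proof -
    obtain N where "N \<in> null_sets lebesgue"
      "{t. \<not> (t \<ge> 0 \<longrightarrow> (\<exists>x''. (v has_real_derivative x'') (at t within {0..}) \<and> x'' + a * v t + b * x t = f t))} \<subseteq> N"
      using ae by (auto simp: eventually_ae_filter)
    then show ?thesis
      by (intro that[of N]) (auto simp: negligible_iff_null_sets, smt (verit) mem_Collect_eq subsetD)
  qed
  have cont_x: "continuous_on {0..} x"
    using x by (auto simp: continuous_on_eq_continuous_within intro!: DERIV_continuous)
  have eq: "v T + a * x T - integral {0..T} f = v 0 + a * x 0 - b * integral {0..T} x" if T: "T \<ge> 0" for T
  proof -
    have "((\<lambda>t. f t - a * v t - b * x t) has_integral (v T - v 0)) {0..T}"
    proof (rule abs_continuous_on_has_integral[OF T _ N(1)])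
      show "abs_continuous_on 0 T v" using ac T by (auto simp: locally_abs_continuous_def)
      show "(v has_real_derivative f t - a * v t - b * x t) (at t within {0..T})" if "t \<in> {0..T} - N" for t
        using N(2)[of t] that by (auto intro: has_field_derivative_subset)
    qed
    moreover have "(v has_integral (x T - x 0)) {0..T}"
    proof (rule fundamental_theorem_of_calculus[OF T])
      fix t assume "t \<in> {0..T}"
      then have "(x has_real_derivative v t) (at t within {0..T})"
        using x[of t] by (auto intro: has_field_derivative_subset)
      then show "(x has_vector_derivative v t) (at t within {0..T})"
        by (simp add: has_real_derivative_iff_has_vector_derivative)
    qed
    then have "((\<lambda>t. a * v t) has_integral a * (x T - x 0)) {0..T}"
      by (rule has_integral_mult_right)
    moreover have "(x has_integral integral {0..T} x) {0..T}"
      by (intro integrable_integral integrable_continuous_real continuous_on_subset[OF cont_x]) auto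
    then have "((\<lambda>t. b * x t) has_integral b * integral {0..T} x) {0..T}"
      by (rule has_integral_mult_right)
    \<comment> \<open>The integrand is \<open>f\<close> split along the equation, so the three
      integrals add up to that of \<open>f\<close>.\<close>
    ultimately have "((\<lambda>t. (f t - a * v t - b * x t) + a * v t + b * x t) has_integral
        (v T - v 0) + a * (x T - x 0) + b * integral {0..T} x) {0..T}"
      by (intro has_integral_add)
    then have "integral {0..T} f = (v T - v 0) + a * (x T - x 0) + b * integral {0..T} x"
      by (simp add: integral_unique)
    then show ?thesis by (simp add: algebra_simps)
  qed
  show ?thesis
  proof (rule that[of v])
    fix t :: real assume t: "t > 0"
    have "at t within {0..} = at t" by (rule at_within_interior) (use t in auto)
    then show "(x has_real_derivative v t) (at t)" using x[of t] t by simp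
    have "((\<lambda>s. integral {0..s} x) has_real_derivative x t) (at t within {0..t + 1})"
      using t by (intro integral_has_real_derivative continuous_on_subset[OF cont_x]) auto
    then have "((\<lambda>s. integral {0..s} x) has_real_derivative x t) (at t)"
      using t by (simp add: at_within_Icc_at)
    then have "((\<lambda>s. v 0 + a * x 0 - b * integral {0..s} x) has_real_derivative - b * x t) (at t)"
      by (auto intro!: derivative_eq_intros)
    then show "((\<lambda>t. v t + a * x t - integral {0..t} f) has_real_derivative - b * x t) (at t)"
      by (rule has_field_derivative_transform_within_open[where S = "{0<..}"]) (use t eq in auto)
  qed
qed

section \<open>Comparison of the limsups\<close>

text \<open>Arbitrarily small \<open>M\<close> are admissible when \<open>A = 0\<close>; a positive
  real \<open>B = r\<close> is refuted by \<open>M = r / (2 * C)\<close>. The strict premise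
  \<open>A < ereal M\<close> is the form in which a limsup yields an eventual bound.\<close>

lemma ereal_zero_of_linear_bound:
  fixes A B :: ereal
  assumes "C > 0" and "\<And>M. \<lbrakk>M > 0; A < ereal M\<rbrakk> \<Longrightarrow> B \<le> ereal (C * M)"
    and "A = 0" "B \<ge> 0"
  shows "B = 0"
proof (cases B)
  case (real r)
  show ?thesis
  proof (rule ccontr)
    assume "B \<noteq> 0"
    with real \<open>B \<ge> 0\<close> have "r > 0" by auto
    then show False
      using assms(1) assms(2)[of "r / (2 * C)"] \<open>A = 0\<close> real by simp
  qed
next
  case PInf
  then show ?thesis using assms(2)[of 1] \<open>A = 0\<close> by simp
qed (use \<open>B \<ge> 0\<close> in auto)

lemma ereal_finite_of_linear_bound:
  fixes A B :: ereal
  assumes "\<And>M. \<lbrakk>M > 0; A < ereal M\<rbrakk> \<Longrightarrow> B \<le> ereal (C * M)"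
    and "A \<ge> 0" "A < \<infinity>"
  shows "B < \<infinity>"
proof -
  from assms(2,3) obtain r where "A = ereal r" "r \<ge> 0" by (cases A) auto
  then have "B \<le> ereal (C * (r + 1))" by (intro assms(1)) auto
  then show ?thesis by (auto intro: le_less_trans)
qed

theorem theorem11:
  fixes a b \<xi>0 \<xi>1 :: real and f x :: "real \<Rightarrow> real"
  assumes "a > 0" and "b > 0"
    and "locally_integrable f"
    and "is_solution a b f \<xi>0 \<xi>1 x"
  shows "(F_bar f = 0 \<longrightarrow> X_bar x = 0) \<and>
         (0 < F_bar f \<and> F_bar f < \<infinity> \<longrightarrow> 0 < X_bar x \<and> X_bar x < \<infinity>) \<and>
         (F_bar f = \<infinity> \<longrightarrow> X_bar x = \<infinity>)"
proof -
  define g where "g t = integral {0..t} f" for t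
  obtain v where v: "\<And>t. t > 0 \<Longrightarrow> (x has_real_derivative v t) (at t)"
    and eq: "\<And>t. t > 0 \<Longrightarrow> ((\<lambda>t. v t + a * x t - g t) has_real_derivative - b * x t) (at t)"
    using is_solution_first_integral[OF assms(3,4)] unfolding g_def by blast
  obtain \<Phi> where \<Phi>: "\<And>t. (\<Phi> has_real_derivative g t) (at t)"
    using antiderivative_exists[of g] locally_integrable_indefinite_integral_continuous[OF assms(3)]
    unfolding g_def by blast
  have F_avg: "F_avg f \<theta>1 \<theta>2 t = second_difference \<Phi> \<theta>1 \<theta>2 t"
    if "t \<ge> 2" "\<theta>1 \<in> {0..1}" "\<theta>2 \<in> {0..1}" for t \<theta>1 \<theta>2
    using F_avg_eq_second_difference[OF assms(3) \<Phi>[unfolded g_def] that] .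

  obtain C where "C > 0" and C: "\<And>M. \<lbrakk>M > 0; F_bar f < ereal M\<rbrakk> \<Longrightarrow> X_bar x \<le> ereal (C * M)"
  proof -
    obtain C where C: "C > 0"
      "\<And>T M. \<lbrakk>\<And>t \<theta>1 \<theta>2. \<lbrakk>t \<ge> T; \<theta>1 \<in> {0..1}; \<theta>2 \<in> {0..1}\<rbrakk> \<Longrightarrow> \<bar>second_difference \<Phi> \<theta>1 \<theta>2 t\<bar> \<le> M; M > 0\<rbrakk>
         \<Longrightarrow> \<forall>\<^sub>F t in at_top. \<bar>x t\<bar> \<le> C * M"
      using response_bounded_by_second_differences[OF assms(1,2) v \<Phi> eq] by blast
    show ?thesis
    proof (rule that[OF C(1)])
      fix M :: real
      assume M: "M > 0" and "F_bar f < ereal M"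
      then have "\<forall>\<^sub>F t in at_top. (SUP (\<theta>1, \<theta>2) \<in> {0..1} \<times> {0..1}. ereal \<bar>F_avg f \<theta>1 \<theta>2 t\<bar>) < ereal M"
        unfolding F_bar_def by (intro Limsup_lessD)
      then obtain T where T: "\<And>t. t \<ge> T \<Longrightarrow> (SUP (\<theta>1, \<theta>2) \<in> {0..1} \<times> {0..1}. ereal \<bar>F_avg f \<theta>1 \<theta>2 t\<bar>) < ereal M"
        by (auto simp: eventually_at_top_linorder)
      have "\<forall>\<^sub>F t in at_top. \<bar>x t\<bar> \<le> C * M"
      \<comment> \<open>From time 2 on the averages coincide with second differences.\<close>
      proof (rule C(2)[OF _ M, of "max T 2"])
        fix t \<theta>1 \<theta>2 :: real
        assume t: "t \<ge> max T 2" and \<theta>: "\<theta>1 \<in> {0..1}" "\<theta>2 \<in> {0..1}"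
        from SUP_lessD[OF T[of t], of "(\<theta>1, \<theta>2)"] t \<theta>
        show "\<bar>second_difference \<Phi> \<theta>1 \<theta>2 t\<bar> \<le> M" by (simp add: F_avg)
      qed
      then show "X_bar x \<le> ereal (C * M)"
        unfolding X_bar_def by (intro Limsup_bounded) simp
    qed
  qed

  define D where "D = 4 + 2 * a + b"
  have "D > 0" using assms(1,2) by (simp add: D_def)
  have D: "F_bar f \<le> ereal (D * N)" if "X_bar x < ereal N" for N
  proof -
    have "\<forall>\<^sub>F t in at_top. ereal \<bar>x t\<bar> < ereal N"
      using that unfolding X_bar_def by (intro Limsup_lessD)
    then obtain T where T: "\<And>t. t \<ge> T \<Longrightarrow> \<bar>x t\<bar> < N"
      by (auto simp: eventually_at_top_linorder)
    \<comment> \<open>The bound by the response needs a positive starting time, and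
      \<open>S + 2\<close> also exceeds 2.\<close>
    define S where "S = max T 1"
    have "\<bar>F_avg f \<theta>1 \<theta>2 t\<bar> \<le> D * N" if "t \<ge> S + 2" "\<theta>1 \<in> {0..1}" "\<theta>2 \<in> {0..1}" for t \<theta>1 \<theta>2
      using second_difference_bounded_by_response[OF assms(1,2) _ v \<Phi> eq _ that, of N] T that F_avg
      by (fastforce simp: S_def D_def)
    then have "\<forall>\<^sub>F t in at_top. (SUP (\<theta>1, \<theta>2) \<in> {0..1} \<times> {0..1}. ereal \<bar>F_avg f \<theta>1 \<theta>2 t\<bar>) \<le> ereal (D * N)"
      by (intro eventually_at_top_linorderI[of "S + 2"] SUP_least) auto
    then show ?thesis unfolding F_bar_def by (rule Limsup_bounded)
  qed

  have X0: "X_bar x \<ge> 0"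
    unfolding X_bar_def by (intro le_Limsup) auto
  have F0: "F_bar f \<ge> 0"
    unfolding F_bar_def by (intro le_Limsup always_eventually allI SUP_upper2[of "(0, 0)"]) auto
  \<comment> \<open>Vanishing and finiteness are each transferred in both directions: (i) is the
    first implication, (ii) combines finiteness with the contrapositive of the second, and (iii) is
    the contrapositive of the last.\<close>
  have "F_bar f = 0 \<Longrightarrow> X_bar x = 0"
    by (rule ereal_zero_of_linear_bound[OF \<open>C > 0\<close> C _ X0])
  moreover have "X_bar x = 0 \<Longrightarrow> F_bar f = 0"
    by (rule ereal_zero_of_linear_bound[OF \<open>D > 0\<close> D _ F0])
  moreover have "F_bar f < \<infinity> \<Longrightarrow> X_bar x < \<infinity>"
    by (rule ereal_finite_of_linear_bound[OF C F0])
  moreover have "X_bar x < \<infinity> \<Longrightarrow> F_bar f < \<infinity>"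
    by (rule ereal_finite_of_linear_bound[OF D X0])
  ultimately show ?thesis
    using X0 F0 by (auto simp: order_less_le)
qed

end
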